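(* (i) Let $S\equiv\pm\{1, 3, 4, 5, 7, 22, 23, 24, 25, 26, 27, 29\}\pmod{60}$ and $T\equiv\pm\{1, 2, 3, 7, 11, 19, 23, 24, 26, 27, 28, 29\}\pmod{60}$. Then $p(S,n)=p(T,n-1)$ for all $n\geq 1$. (ii) Let $S\equiv\pm\{2, 7, 9, 11, 12, 13, 14, 16, 17, 19, 21, 23\}\pmod{60}$ and $T\equiv\pm\{2, 5, 7, 9, 11, 12, 19, 21, 23, 25, 26, 28\}\pmod{60}$. Then $p(S,n)=p(T,n-2)$ for all $n\geq 2$. (iii) Let $S\equiv\pm\{2, 3, 5, 11, 13, 14, 16, 17, 19, 24, 25, 27\}\pmod{60}$ and $T\equiv\pm\{1, 3, 8, 11, 13, 14, 17, 19, 22, 24, 27, 29\}\pmod{60}$. Then $p(S,n)=p(T,n-2)$ for all $n\geq 2$. (iv) Let $S\equiv\pm\{1, 5, 8, 9, 12, 13, 14, 17, 21, 22, 25, 29\}\pmod{60}$ and $T\equiv\pm\{1, 4, 7, 9, 12, 13, 17, 21, 22, 23, 26, 29\}\pmod{60}$. Then $p(S,n)=p(T,n-1)$ for all $n\geq 1$.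
   Context: For a set $S$ of positive integers and an integer $n\ge 0$, $p(S,n)$ denotes the number of partitions of $n$ into parts belonging to $S$ (so $p(S,0)=1$). The notation $S\equiv\pm\{r_1,\dots,r_k\}\pmod M$ means that $S$ is the set of all positive integers $n$ such that $n\equiv r_i$ or $n\equiv -r_i\pmod M$ for some $i$. *)

theory Defs
  imports "HOL-Library.Multiset" "HOL-Number_Theory.Cong"
begin

text \<open>A partition is the finite multiset of its parts. The definition is intended for sets \<open>S\<close>
  of positive integers; then the set being counted is finite (lemma \<open>finite_partitions_into\<close>),
  so that \<open>card\<close> is the true count.\<close>

definition partitions_into :: "nat set \<Rightarrow> nat \<Rightarrow> nat multiset set" where
  "partitions_into S n = {P. set_mset P \<subseteq> S \<and> sum_mset P = n}"

definition num_partitions :: "nat set \<Rightarrow> nat \<Rightarrow> nat" where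
  "num_partitions S n = card (partitions_into S n)"

definition pm_residues :: "int set \<Rightarrow> int \<Rightarrow> nat set" where
  "pm_residues R M = {n. n > 0 \<and> (\<exists>r\<in>R. [int n = r] (mod M) \<or> [int n = - r] (mod M))}"

lemma size_le_sum_mset:
  fixes P :: "nat multiset"
  assumes "0 \<notin># P"
  shows "size P \<le> sum_mset P"
  using assms by (induction P) auto

lemma finite_partitions_into:
  assumes "0 \<notin> S"
  shows "finite (partitions_into S n)"
proof (rule finite_subset)
  show "partitions_into S n \<subseteq> mset ` {xs. set xs \<subseteq> {..n} \<and> length xs \<le> n}"
  proof
    fix P assume P: "P \<in> partitions_into S n"
    obtain xs where xs: "P = mset xs" by (metis ex_mset)
    have "0 \<notin># P" using P assms by (auto simp: partitions_into_def)
    then have "length xs \<le> n"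
      using P size_le_sum_mset[of P] by (simp add: partitions_into_def xs)
    moreover have "x \<le> n" if "x \<in> set xs" for x
      using P member_le_sum_list[OF that] by (simp add: partitions_into_def xs sum_mset_sum_list)
    ultimately show "P \<in> mset ` {xs. set xs \<subseteq> {..n} \<and> length xs \<le> n}"
      using xs by auto
  qed
  show "finite (mset ` {xs. set xs \<subseteq> {..n} \<and> length xs \<le> n})"
    by (intro finite_imageI finite_lists_length_le) simp
qed

end

theory Submission
  imports Defs "HOL-Analysis.Analysis"
begin

text \<open>
  Write \<open>\<theta>(x; Q) = \<Prod>(1 - x Q\<^sup>k)(1 - Q\<^sup>k\<^sup>+\<^sup>1/x)\<close> and \<open>J\<^sub>r = \<theta>(q\<^sup>r; q\<^sup>6\<^sup>0)\<close>. The generating function of the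
  partitions with parts congruent to plus or minus an element of \<open>R\<close> modulo 60 is the reciprocal of
  the product of the \<open>J\<^sub>r\<close>, \<open>r \<in> R\<close>, so each of the four claims says that
  \<open>1/\<Prod>J\<^sub>s - q\<^sup>e/\<Prod>J\<^sub>t = 1\<close> for \<open>0 < q < 1\<close>. Each of these is a single instance of Weierstrass'
  three-term relation for \<open>\<theta>(_; q\<^sup>3\<^sup>0)\<close>, taken at four points of the form \<open>q\<^sup>a\<close> or \<open>- q\<^sup>a\<close>, because
  \<open>\<theta>(q\<^sup>r; q\<^sup>3\<^sup>0) = J\<^sub>r J\<^sub>3\<^sub>0\<^sub>-\<^sub>r\<close> and \<open>\<theta>(- q\<^sup>r; q\<^sup>3\<^sup>0) = J\<^sub>2\<^sub>r / (J\<^sub>r J\<^sub>3\<^sub>0\<^sub>-\<^sub>r)\<close>.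

  The Jacobi triple product turns \<open>\<theta>(xy) \<theta>(x/y)\<close> into a double series; splitting it by the parity of
  the sum of the indices gives \<open>A(x) B(y) - (x/y) B(x) A(y)\<close>, and Weierstrass' relation
  becomes the Pluecker relation between 2 by 2 minors.
\<close>

section \<open>Generating functions of partitions\<close>

text \<open>A partition either avoids \<open>m\<close> or has a copy of \<open>m\<close> to remove.
  The remainder may contain \<open>m\<close> again, so the second piece refers to
  \<open>insert m S\<close> itself.\<close>

lemma partitions_into_insert:
  assumes "m \<notin> S"
  shows "partitions_into (insert m S) n = partitions_into S n \<union>
    (if m \<le> n then add_mset m ` partitions_into (insert m S) (n - m) else {})"
proof (intro equalityI subsetI)
  fix P assume P: "P \<in> partitions_into (insert m S) n"
  show "P \<in> partitions_into S n \<union>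
    (if m \<le> n then add_mset m ` partitions_into (insert m S) (n - m) else {})"
  proof (cases "m \<in># P")
    case True
    then obtain P' where P': "P = add_mset m P'" by (metis insert_DiffM)
    with P have "m \<le> n" "P' \<in> partitions_into (insert m S) (n - m)"
      by (auto simp: partitions_into_def)
    with P' show ?thesis by simp
  next
    case False
    with P show ?thesis by (auto simp: partitions_into_def)
  qed
next
  fix P assume "P \<in> partitions_into S n \<union>
    (if m \<le> n then add_mset m ` partitions_into (insert m S) (n - m) else {})"
  then consider "P \<in> partitions_into S n"
    | P' where "m \<le> n" "P' \<in> partitions_into (insert m S) (n - m)" "P = add_mset m P'"
    by (auto split: if_splits)
  then show "P \<in> partitions_into (insert m S) n"
    by cases (auto simp: partitions_into_def)
qed

lemma num_partitions_insert:
  assumes "m \<notin> S" "0 < m" "0 \<notin> S"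
  shows "num_partitions (insert m S) n = num_partitions S n +
    (if m \<le> n then num_partitions (insert m S) (n - m) else 0)"
proof -
  have fin: "finite (partitions_into S k)" "finite (partitions_into (insert m S) k)" for k
    using assms by (auto intro!: finite_partitions_into)
  have "partitions_into S n \<inter> add_mset m ` partitions_into (insert m S) (n - m) = {}"
  proof -
    have "m \<notin># P" if "P \<in> partitions_into S n" for P
      using that assms(1) unfolding partitions_into_def by blast
    then show ?thesis by fastforce
  qed
  then have "card (partitions_into S n \<union> add_mset m ` partitions_into (insert m S) (n - m)) =
      num_partitions S n + num_partitions (insert m S) (n - m)"
    by (simp add: card_Un_disjoint card_image inj_on_def fin num_partitions_def)
  moreover have "num_partitions (insert m S) n = card (partitions_into S n \<union>
      (if m \<le> n then add_mset m ` partitions_into (insert m S) (n - m) else {}))"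
    unfolding num_partitions_def by (intro arg_cong[where f = card] partitions_into_insert assms)
  ultimately show ?thesis by (cases "m \<le> n") (simp_all add: num_partitions_def)
qed

lemma num_partitions_empty: "num_partitions {} n = (if n = 0 then 1 else 0)"
proof -
  have "partitions_into {} n = (if n = 0 then {{#}} else {})"
    by (auto simp: partitions_into_def)
  then show ?thesis by (simp add: num_partitions_def)
qed

lemma num_partitions_Int_lessThan:
  assumes "n < N"
  shows "num_partitions (S \<inter> {..<N}) n = num_partitions S n"
proof -
  have "x \<le> n" if "x \<in># P" "sum_mset P = n" for x P
    using that by (auto dest: multi_member_split)
  then have "partitions_into (S \<inter> {..<N}) n = partitions_into S n"
    using assms by (fastforce simp: partitions_into_def)
  then show ?thesis by (simp add: num_partitions_def)
qed

lemma num_partitions_mono: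
  assumes "S \<subseteq> T" "0 \<notin> T"
  shows "num_partitions S n \<le> num_partitions T n"
  unfolding num_partitions_def using assms
  by (intro card_mono finite_partitions_into) (auto simp: partitions_into_def)

text \<open>Adjoining one part size \<open>m\<close> turns the series \<open>a\<close> of
  \<open>S\<close> into a series \<open>c\<close> with \<open>c n = a n + q ^ m * c (n - m)\<close>.
  Summing over \<open>n\<close> gives \<open>C = s + q ^ m * C\<close>, hence one further factor
  \<open>1 / (1 - q ^ m)\<close>.\<close>

lemma sums_num_partitions_finite:
  fixes q :: real
  assumes "finite S" "0 \<notin> S" "0 < q" "q < 1"
  shows "(\<lambda>n. real (num_partitions S n) * q ^ n) sums inverse (\<Prod>m\<in>S. 1 - q ^ m)"
  using assms(1,2)
proof (induction S rule: finite_induct)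
  case empty
  show ?case
  proof -
    have "(\<lambda>n. real (num_partitions {} n) * q ^ n) = (\<lambda>n. if n = 0 then q ^ n else 0)"
      by (auto simp: num_partitions_empty)
    then show ?thesis using sums_single[of 0 "\<lambda>n. q ^ n"] by simp
  qed
next
  case (insert m S)
  define a where "a n = real (num_partitions S n) * q ^ n" for n
  define c where "c n = real (num_partitions (insert m S) n) * q ^ n" for n
  define s where "s = inverse (\<Prod>m\<in>S. 1 - q ^ m)"
  have m: "0 < m" "0 \<notin> S" using insert.prems by (auto intro: Nat.gr0I)
  then have qm: "0 < q ^ m" "q ^ m < 1"
    using assms by (simp_all add: power_less_one_iff)
  have a: "a sums s" unfolding a_def s_def using insert m by simp
  have c_rec: "c n = a n + (if n < m then 0 else q ^ m * c (n - m))" for n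
    using num_partitions_insert[OF insert.hyps(2) m, of n]
    by (auto simp: a_def c_def distrib_right power_add[symmetric] mult.left_commute[of "q ^ m"])
  have nonneg: "a n \<ge> 0" "c n \<ge> 0" for n using assms by (auto simp: a_def c_def)
  \<comment> \<open>Convergence of \<open>c\<close> has to come before the equation for its sum. The
    recurrence itself bounds the partial sums: the shifted sum has only \<open>N - m\<close> of the
    nonnegative terms, so it is at most \<open>q ^ m * sum c {..<N}\<close>.\<close>
  have "sum c {..<N} \<le> s / (1 - q ^ m)" for N
  proof -
    have sum_c: "sum c {..<N} = sum a {..<N} + (\<Sum>n<N. if n < m then 0 else q ^ m * c (n - m))"
      unfolding sum.distrib[symmetric] by (intro sum.cong refl c_rec)
    have "(\<Sum>n<N. if n < m then 0 else q ^ m * c (n - m)) = (\<Sum>n\<in>{m..<N}. q ^ m * c (n - m))"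
      by (rule sum.mono_neutral_cong_right) auto
    also have "\<dots> = (\<Sum>n<N - m. q ^ m * c n)"
      by (rule sum.reindex_bij_witness[of _ "\<lambda>n. n + m" "\<lambda>n. n - m"]) auto
    also have "\<dots> \<le> q ^ m * sum c {..<N}"
      unfolding sum_distrib_left[symmetric] using qm nonneg
      by (intro mult_left_mono sum_mono2) auto
    finally have "sum c {..<N} \<le> sum a {..<N} + q ^ m * sum c {..<N}"
      using sum_c by linarith
    moreover have "sum a {..<N} \<le> s"
      using sum_le_suminf[OF sums_summable[OF a], of "{..<N}"] nonneg sums_unique[OF a] by simp
    ultimately show ?thesis using qm by (simp add: field_simps)
  qed
  then have "summable c"
    using nonneg by (intro summableI_nonneg_bounded[of c "s / (1 - q ^ m)"]) auto
  then obtain C where C: "c sums C" by (auto simp: summable_def)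
  have "(\<lambda>n. if n < m then 0 else q ^ m * c (n - m)) sums (q ^ m * C)"
    using sums_mult[OF C, of "q ^ m"]
    by (subst sums_iff_shift'[of _ m, symmetric]) (simp add: sum.neutral)
  from sums_add[OF a this] have "c sums (s + q ^ m * C)"
    unfolding c_rec[symmetric] .
  with C have "C = s + q ^ m * C" using sums_unique2 by blast
  then have "C = inverse (1 - q ^ m) * s" using qm by (simp add: field_simps)
  with C show ?case using insert by (simp add: c_def[abs_def] s_def)
qed

text \<open>A squeeze between finite truncations of \<open>S\<close>. Partitions of \<open>n\<close>
  use parts at most \<open>n\<close>, so the partial sums of the series lie below the truncated
  values \<open>F K\<close>; conversely each \<open>F N\<close> lies below the full sum, because
  fewer parts give fewer partitions. Cutting at multiples of \<open>M\<close> lets residue classes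
  modulo \<open>M\<close> be treated one period at a time.\<close>

lemma sums_num_partitions:
  fixes q :: real
  assumes "0 \<notin> S" "0 < q" "q < 1" "0 < M"
    and lim: "(\<lambda>N. \<Prod>m\<in>S \<inter> {..<M * N}. 1 - q ^ m) \<longlonglongrightarrow> P" and "P \<noteq> 0"
  shows "(\<lambda>n. real (num_partitions S n) * q ^ n) sums inverse P"
proof -
  define c where "c n = real (num_partitions S n) * q ^ n" for n
  define F where "F N = inverse (\<Prod>m\<in>S \<inter> {..<M * N}. 1 - q ^ m)" for N
  have lim': "F \<longlonglongrightarrow> inverse P" unfolding F_def using lim \<open>P \<noteq> 0\<close> by (rule tendsto_inverse)
  have F: "(\<lambda>n. real (num_partitions (S \<inter> {..<M * N}) n) * q ^ n) sums F N" for N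
    unfolding F_def using assms by (intro sums_num_partitions_finite) auto
  have nonneg: "c n \<ge> 0" for n using assms by (simp add: c_def)
  have le_F: "sum c {..<N} \<le> F K" if "N \<le> K" for N K
  proof -
    have "n < M * K" if "n < N" for n
    proof -
      have "K \<le> M * K" using \<open>0 < M\<close> by simp
      with that \<open>N \<le> K\<close> show ?thesis by linarith
    qed
    then have "sum c {..<N} = (\<Sum>n<N. real (num_partitions (S \<inter> {..<M * K}) n) * q ^ n)"
      by (intro sum.cong) (auto simp: c_def num_partitions_Int_lessThan)
    also have "\<dots> \<le> F K"
      using sum_le_suminf[OF sums_summable[OF F], of "{..<N}" K] sums_unique[OF F, of K] assms by simp
    finally show ?thesis .
  qed
  have bound: "sum c {..<N} \<le> inverse P" for N
    by (rule tendsto_lowerbound[OF lim']) (auto simp: eventually_sequentially intro: le_F)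
  have "summable c"
    using nonneg bound by (intro summableI_nonneg_bounded[of c "inverse P"]) auto
  then obtain C where C: "c sums C" by (auto simp: summable_def)
  have "F N \<le> C" for N
    by (rule sums_le[OF _ F C])
       (use assms in \<open>auto simp: c_def intro!: mult_right_mono num_partitions_mono\<close>)
  with lim' have "inverse P \<le> C" by (intro tendsto_upperbound[OF lim']) auto
  moreover have "C \<le> inverse P"
    using C bound unfolding sums_def by (intro tendsto_upperbound[of _ C sequentially]) auto
  ultimately show ?thesis using C by (simp add: c_def[abs_def])
qed

text \<open>Once the coefficients below \<open>n\<close> vanish, the series can be divided by
  \<open>q ^ n\<close>; as \<open>q\<close> tends to 0 its value tends to \<open>h n\<close>. The
  limit is one-sided because the identity is given for positive \<open>q\<close> only.\<close>

lemma powser_sums_0_imp_coeff_0: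
  fixes h :: "nat \<Rightarrow> real"
  assumes "\<And>q. 0 < q \<Longrightarrow> q < 1 \<Longrightarrow> (\<lambda>n. h n * q ^ n) sums 0"
  shows "h n = 0"
proof (induction n rule: less_induct)
  case (less n)
  define g where "g k = h (k + n)" for k
  have g: "(\<lambda>k. g k * q ^ k) sums 0" if q: "0 < q" "q < 1" for q
  proof -
    have "(\<lambda>k. h (k + n) * q ^ (k + n)) sums 0"
      using assms[OF q] less by (subst sums_iff_shift) simp
    from sums_mult[OF this, of "inverse (q ^ n)"] show ?thesis
      using q by (simp add: g_def power_add field_simps)
  qed
  have "isCont (\<lambda>x. \<Sum>k. g k * x ^ k) 0"
    using g[of "1/2"] by (intro isCont_powser[of g "1/2"]) (auto intro: sums_summable)
  then have "((\<lambda>x. \<Sum>k. g k * x ^ k) \<longlongrightarrow> g 0) (at_right 0)"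
    unfolding isCont_def filterlim_at_split by simp
  moreover have "((\<lambda>x. \<Sum>k. g k * x ^ k) \<longlongrightarrow> 0) (at_right 0)"
    by (rule tendsto_eventually)
       (auto simp: eventually_at_right_field intro!: exI[of _ 1] sums_unique[symmetric] g)
  ultimately have "g 0 = 0" using tendsto_unique trivial_limit_at_right_real by blast
  then show ?case by (simp add: g_def)
qed

section \<open>The Jacobi triple product\<close>

text \<open>The infinite q-Pochhammer symbol; \<open>qtheta\<close> below is the modified Jacobi
  theta function, that is, the triple product without its factor \<open>qpoch q q\<close>.\<close>

definition qpoch :: "real \<Rightarrow> real \<Rightarrow> real" where
  "qpoch a q = (\<Prod>k. 1 - a * q ^ k)"

definition qtheta :: "real \<Rightarrow> real \<Rightarrow> real" where
  "qtheta x q = qpoch x q * qpoch (q / x) q"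

lemma convergent_prod_qpoch:
  fixes a q :: real
  assumes "0 < q" "q < 1"
  shows "convergent_prod (\<lambda>k. 1 - a * q ^ k)"
proof -
  have "summable (\<lambda>k. norm ((1 - a * q ^ k) - 1))"
    using assms by (auto simp: abs_mult power_abs intro!: summable_mult summable_geometric)
  then show ?thesis
    by (intro abs_convergent_prod_imp_convergent_prod summable_imp_abs_convergent_prod)
qed

lemma qpoch_LIMSEQ:
  assumes "0 < q" "q < 1"
  shows "(\<lambda>n. \<Prod>k<n. 1 - a * q ^ k) \<longlonglongrightarrow> qpoch a q"
  unfolding qpoch_def
  by (intro has_prod_imp_tendsto' convergent_prod_has_prod convergent_prod_qpoch assms)

lemma qpoch_nonzero:
  assumes "0 < q" "q < 1" "\<And>k. a * q ^ k \<noteq> 1"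
  shows "qpoch a q \<noteq> 0"
  unfolding qpoch_def using assms
  by (intro prodinf_nonzero convergent_prod_qpoch) auto

lemma qpoch_mult_minus:
  assumes "0 < q" "q < 1"
  shows "qpoch a q * qpoch (- a) q = qpoch (a\<^sup>2) (q\<^sup>2)"
proof -
  have "qpoch a q * qpoch (- a) q = (\<Prod>k. (1 - a * q ^ k) * (1 - (- a) * q ^ k))"
    unfolding qpoch_def by (intro prodinf_mult convergent_prod_qpoch assms)
  also have "(\<lambda>k. (1 - a * q ^ k) * (1 - (- a) * q ^ k)) = (\<lambda>k. 1 - a\<^sup>2 * (q\<^sup>2) ^ k)"
    by (auto simp: algebra_simps power2_eq_square power_mult_distrib)
  finally show ?thesis by (simp add: qpoch_def)
qed

text \<open>The factors of even and of odd index \<open>k\<close> form the two products on the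
  right.\<close>

lemma qpoch_dissect:
  assumes "0 < q" "q < 1"
  shows "qpoch a q = qpoch a (q\<^sup>2) * qpoch (a * q) (q\<^sup>2)"
proof -
  have q2: "0 < q\<^sup>2" "q\<^sup>2 < 1" using assms by (auto simp: power_less_one_iff)
  have "(\<Prod>k<2 * n. 1 - a * q ^ k) = (\<Prod>k<n. 1 - a * (q\<^sup>2) ^ k) * (\<Prod>k<n. 1 - a * q * (q\<^sup>2) ^ k)" for n
  proof (induction n)
    case (Suc n)
    have "q ^ (2 * n) = (q\<^sup>2) ^ n" by (simp add: power_mult)
    then show ?case using Suc by (simp add: mult_ac)
  qed simp
  moreover have "(\<lambda>n. \<Prod>k<2 * n. 1 - a * q ^ k) \<longlonglongrightarrow> qpoch a q"
    by (rule filterlim_compose[OF qpoch_LIMSEQ[OF assms] mult_nat_left_at_top]) simp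
  moreover have "(\<lambda>n. (\<Prod>k<n. 1 - a * (q\<^sup>2) ^ k) * (\<Prod>k<n. 1 - a * q * (q\<^sup>2) ^ k))
      \<longlonglongrightarrow> qpoch a (q\<^sup>2) * qpoch (a * q) (q\<^sup>2)"
    by (intro tendsto_mult qpoch_LIMSEQ q2)
  ultimately show ?thesis using LIMSEQ_unique by simp
qed

section \<open>Gaussian binomial coefficients and the finite triple product\<close>

text \<open>The Gaussian binomial coefficient, given by a q-Pascal rule so that no division occurs.
  For \<open>k > n\<close> the truncated exponent \<open>n - k\<close> is harmless, since it
  multiplies \<open>qbinomial q n k = 0\<close>.\<close>

fun qbinomial :: "real \<Rightarrow> nat \<Rightarrow> nat \<Rightarrow> real" where
  "qbinomial q n 0 = 1"
| "qbinomial q 0 (Suc k) = 0"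
| "qbinomial q (Suc n) (Suc k) = qbinomial q n (Suc k) + q ^ (n - k) * qbinomial q n k"

lemma qbinomial_eq_0: "n < k \<Longrightarrow> qbinomial q n k = 0"
  by (induction q n k rule: qbinomial.induct) auto

lemma qbinomial_theorem:
  "(\<Prod>k<n. 1 + y * q ^ k) = (\<Sum>k\<le>n. q ^ (k choose 2) * y ^ k * qbinomial q n k)"
proof (induction n)
  case (Suc n)
  let ?t = "\<lambda>n k. q ^ (k choose 2) * y ^ k * qbinomial q n k"
  have "(\<Sum>k\<le>Suc n. ?t (Suc n) k) = 1 + (\<Sum>k\<le>n. ?t (Suc n) (Suc k))"
    by (simp add: sum.atMost_Suc_shift binomial_eq_0 del: sum.atMost_Suc qbinomial.simps(3))
  also have "(\<Sum>k\<le>n. ?t (Suc n) (Suc k)) = (\<Sum>k\<le>n. ?t n (Suc k) + ?t n k * (y * q ^ n))"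
  proof (intro sum.cong refl)
    fix k assume "k \<in> {..n}"
    then have "q ^ n = q ^ k * q ^ (n - k)" by (simp flip: power_add)
    then show "?t (Suc n) (Suc k) = ?t n (Suc k) + ?t n k * (y * q ^ n)"
      by (simp add: numeral_2_eq_2 power_add algebra_simps)
  qed
  also have "1 + \<dots> = (1 + (\<Sum>k\<le>n. ?t n (Suc k))) + (\<Sum>k\<le>n. ?t n k) * (y * q ^ n)"
    by (simp add: sum.distrib sum_distrib_right)
  also have "1 + (\<Sum>k\<le>n. ?t n (Suc k)) = (\<Sum>k\<le>Suc n. ?t n k)"
    by (simp add: sum.atMost_Suc_shift binomial_eq_0 del: sum.atMost_Suc)
  also have "\<dots> = (\<Sum>k\<le>n. ?t n k)" by (simp add: qbinomial_eq_0)
  finally show ?case by (simp add: Suc algebra_simps)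
qed (simp add: binomial_eq_0)

text \<open>The quotient formula for Gaussian binomials with denominators cleared. The two terms of
  the Pascal rule contribute \<open>1 - q ^ (n - k)\<close> and
  \<open>q ^ (n - k) - q * q ^ n\<close> times the product for \<open>n\<close>, which add up to the
  new factor \<open>1 - q * q ^ n\<close>.\<close>

lemma qbinomial_fact:
  assumes "k \<le> n"
  shows "qbinomial q n k * (\<Prod>i<k. 1 - q * q ^ i) * (\<Prod>i<n - k. 1 - q * q ^ i) = (\<Prod>i<n. 1 - q * q ^ i)"
  using assms
proof (induction q n k rule: qbinomial.induct)
  case (3 q n k)
  let ?f = "\<lambda>n. \<Prod>i<n. 1 - q * q ^ i"
  show ?case
  proof (cases "k = n")
    case True
    have "qbinomial q (Suc n) (Suc k) * ?f (Suc k) * ?f (Suc n - Suc k) =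
        (qbinomial q n n * ?f n * ?f (n - n)) * (1 - q * q ^ n)"
      using True by (simp add: qbinomial_eq_0)
    also have "\<dots> = ?f (Suc n)" using 3 True by simp
    finally show ?thesis .
  next
    case False
    then have k: "k < n" using 3 by simp
    then have nk: "n - k = Suc (n - Suc k)" by simp
    have "q ^ (n - k) * q ^ k = q ^ n" using k by (simp flip: power_add)
    then have qk: "q ^ (n - k) * (1 - q * q ^ k) = q ^ (n - k) - q * q ^ n"
      by (simp add: algebra_simps)
    have "qbinomial q n (Suc k) * ?f (Suc k) * ?f (n - k) =
        (qbinomial q n (Suc k) * ?f (Suc k) * ?f (n - Suc k)) * (1 - q ^ (n - k))"
      unfolding nk by simp
    also have "\<dots> = ?f n * (1 - q ^ (n - k))" using 3 k by simp
    finally have 1: "qbinomial q n (Suc k) * ?f (Suc k) * ?f (n - k) = ?f n * (1 - q ^ (n - k))" .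
    have "q ^ (n - k) * qbinomial q n k * ?f (Suc k) * ?f (n - k) =
        (qbinomial q n k * ?f k * ?f (n - k)) * (q ^ (n - k) * (1 - q * q ^ k))"
      by simp
    also have "\<dots> = ?f n * (q ^ (n - k) - q * q ^ n)" unfolding qk using 3 k by simp
    finally have 2: "q ^ (n - k) * qbinomial q n k * ?f (Suc k) * ?f (n - k) =
        ?f n * (q ^ (n - k) - q * q ^ n)" .
    have "qbinomial q (Suc n) (Suc k) * ?f (Suc k) * ?f (Suc n - Suc k) =
        ?f n * (1 - q ^ (n - k)) + ?f n * (q ^ (n - k) - q * q ^ n)"
      unfolding 1[symmetric] 2[symmetric] qbinomial.simps diff_Suc_Suc by (simp only: algebra_simps)
    also have "\<dots> = ?f (Suc n)" by (simp add: algebra_simps)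
    finally show ?thesis .
  qed
qed auto

text \<open>Recentres the exponents of the q-binomial theorem around a two-sided index;
  \<open>j = 0\<close> identifies the integer expression with a binomial coefficient.\<close>

lemma triangular_int_add:
  "(j + int n) * (j + int n - 1) div 2 = j * (j - 1) div 2 + j * int n + int (n choose 2)"
proof -
  have "even (j * (j - 1))" "even (int n * (int n - 1))" by auto
  then obtain a b where ab: "j * (j - 1) = 2 * a" "int n * (int n - 1) = 2 * b" by (meson evenE)
  have "2 * int (n choose 2) = int n * (int n - 1)"
    by (induction n) (auto simp: numeral_2_eq_2 algebra_simps)
  then have "int (n choose 2) = b"
    using ab(2) by linarith
  moreover have "(j + int n) * (j + int n - 1) = 2 * (a + j * int n + b)"
    using ab by (simp add: algebra_simps)
  ultimately show ?thesis using ab(1) by simp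
qed

text \<open>Reverse the order of the factors, then extract \<open>x / q ^ Suc k\<close> from each.
  This produces the factors in \<open>q / x\<close> of the triple product.\<close>

lemma prod_one_plus_shifted:
  fixes x q :: real
  assumes "q \<noteq> 0" "x \<noteq> 0"
  shows "(\<Prod>k<n. 1 + x / q ^ n * q ^ k) = x ^ n / q ^ (Suc n choose 2) * (\<Prod>k<n. 1 + q / x * q ^ k)"
proof -
  have "(\<Prod>k<n. 1 + x / q ^ n * q ^ k) = (\<Prod>k<n. 1 + x / q ^ n * q ^ (n - Suc k))"
    by (rule prod.nat_diff_reindex[symmetric])
  also have "\<dots> = (\<Prod>k<n. x / q ^ Suc k * (1 + q / x * q ^ k))"
  proof (intro prod.cong refl)
    fix k assume "k \<in> {..<n}"
    then have "q ^ n = q ^ (n - Suc k) * q ^ Suc k" by (simp del: power_Suc flip: power_add)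
    then show "1 + x / q ^ n * q ^ (n - Suc k) = x / q ^ Suc k * (1 + q / x * q ^ k)"
      using assms by (simp add: field_simps)
  qed
  also have "\<dots> = (\<Prod>k<n. x / q ^ Suc k) * (\<Prod>k<n. 1 + q / x * q ^ k)"
    by (rule prod.distrib)
  also have "(\<Prod>k<n. x / q ^ Suc k) = x ^ n / q ^ (Suc n choose 2)"
    by (induction n) (simp_all add: numeral_2_eq_2 power_add mult_ac)
  finally show ?thesis .
qed

text \<open>The q-binomial theorem for \<open>2 * n\<close> factors at \<open>y = x / q ^ n\<close>,
  with the index centred by \<open>j = k - n\<close>. The upper half of the factors is the product
  in \<open>x\<close>, the lower half the reversed product in \<open>q / x\<close>; the prefactor
  \<open>?c\<close> arises on both sides and cancels.\<close>

lemma finite_jacobi_triple_product: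
  fixes x q :: real
  assumes "q \<noteq> 0" "x \<noteq> 0"
  shows "(\<Prod>k<n. 1 + x * q ^ k) * (\<Prod>k<n. 1 + q / x * q ^ k) =
    (\<Sum>j\<in>{-int n..int n}. q powi (j * (j - 1) div 2) * x powi j * qbinomial q (2 * n) (nat (j + int n)))"
proof -
  let ?c = "x ^ n / q ^ (Suc n choose 2)"
  have "?c * ((\<Prod>k<n. 1 + x * q ^ k) * (\<Prod>k<n. 1 + q / x * q ^ k)) =
      (\<Prod>k<n. 1 + x / q ^ n * q ^ k) * (\<Prod>k<n. 1 + x / q ^ n * q ^ (n + k))"
    unfolding prod_one_plus_shifted[OF assms] using assms by (simp add: power_add mult_ac)
  also have "\<dots> = (\<Prod>k<2 * n. 1 + x / q ^ n * q ^ k)"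
  proof -
    have "prod f {..<n + m} = prod f {..<n} * (\<Prod>k<m. f (n + k))" for f :: "nat \<Rightarrow> real" and m
      by (induction m) (simp_all add: mult_ac)
    then show ?thesis by (simp only: mult_2)
  qed
  also have "\<dots> = (\<Sum>k\<le>2 * n. q ^ (k choose 2) * (x / q ^ n) ^ k * qbinomial q (2 * n) k)"
    by (rule qbinomial_theorem)
  also have "\<dots> = (\<Sum>j\<in>{-int n..int n}. ?c * (q powi (j * (j - 1) div 2) * x powi j *
      qbinomial q (2 * n) (nat (j + int n))))"
  proof (rule sum.reindex_bij_witness[of _ "\<lambda>j. nat (j + int n)" "\<lambda>k. int k - int n"], goal_cases)
    case (5 k)
    define j where "j = int k - int n"
    have k: "int k = j + int n" by (simp add: j_def)
    have "int (k choose 2) = j * (j - 1) div 2 + j * int n + int (n choose 2)"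
      using triangular_int_add[of 0 k] triangular_int_add[of j n] unfolding k[symmetric] by simp
    then have "q ^ (k choose 2) = q powi (j * (j - 1) div 2) * q powi (j * int n) * q ^ (n choose 2)"
      using assms by (metis power_int_add power_int_of_nat)
    moreover have "(x / q ^ n) ^ k = x powi j * x ^ n / (q powi (j * int n) * q ^ (n * n))"
    proof -
      have "(x / q ^ n) ^ k = (x / q ^ n) powi (j + int n)" by (simp flip: k)
      then show ?thesis using assms
        by (simp add: power_int_add power_int_divide_distrib power_int_mult power_divide
            power_int_mult[of q "int n" j, simplified] mult.commute[of j] power_mult)
    qed
    moreover have "q ^ (n * n) = q ^ (n choose 2) * q ^ (Suc n choose 2)"
    proof -
      have "n * n = (n choose 2) + (Suc n choose 2)"
        by (induction n) (auto simp: numeral_2_eq_2)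
      then show ?thesis by (metis power_add)
    qed
    ultimately show ?case using assms by (simp add: j_def[symmetric] k[symmetric] field_simps)
  qed auto
  also have "\<dots> = ?c * (\<Sum>j\<in>{-int n..int n}. q powi (j * (j - 1) div 2) * x powi j *
      qbinomial q (2 * n) (nat (j + int n)))"
    by (rule sum_distrib_left[symmetric])
  finally show ?thesis using assms by simp
qed

section \<open>The two-sided theta series and the passage to the limit\<close>

text \<open>An unconditional sum over all integers, so that the index set may be split and reindexed
  freely.\<close>

definition theta_sum :: "real \<Rightarrow> real \<Rightarrow> real" where
  "theta_sum x q = (\<Sum>\<^sub>\<infinity>j::int. q powi (j * (j - 1) div 2) * x powi j)"

text \<open>Consecutive terms have the ratio \<open>x * q ^ k\<close>, which tends to 0.\<close>

lemma summable_theta_sum_nat: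
  fixes x q :: real
  assumes "0 < q" "q < 1" "0 < x"
  shows "summable (\<lambda>k. q ^ (k choose 2) * x ^ k)"
proof -
  have "(\<lambda>k. x * q ^ k) \<longlonglongrightarrow> 0"
    using assms tendsto_mult[OF tendsto_const LIMSEQ_power_zero[of q], of x] by simp
  then have "eventually (\<lambda>k. x * q ^ k < 1 / 2) sequentially"
    by (rule order_tendstoD) simp
  then obtain N where N: "\<And>k. k \<ge> N \<Longrightarrow> x * q ^ k < 1 / 2" by (auto simp: eventually_sequentially)
  show ?thesis
  proof (rule summable_ratio_test[of "1/2" N])
    fix k assume "k \<ge> N"
    have "norm (q ^ (Suc k choose 2) * x ^ Suc k) = (x * q ^ k) * norm (q ^ (k choose 2) * x ^ k)"
      using assms by (simp add: numeral_2_eq_2 power_add abs_mult)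
    also have "\<dots> \<le> 1 / 2 * norm (q ^ (k choose 2) * x ^ k)"
      using N[OF \<open>k \<ge> N\<close>] by (intro mult_right_mono) auto
    finally show "norm (q ^ (Suc k choose 2) * x ^ Suc k) \<le> 1 / 2 * norm (q ^ (k choose 2) * x ^ k)" .
  qed simp
qed

lemma summable_on_theta_sum_abs:
  fixes x q :: real
  assumes "0 < q" "q < 1" "x \<noteq> 0"
  shows "(\<lambda>j::int. \<bar>q powi (j * (j - 1) div 2) * x powi j\<bar>) summable_on UNIV"
proof -
  let ?f = "\<lambda>j::int. \<bar>q powi (j * (j - 1) div 2) * x powi j\<bar>"
  have nat: "(\<lambda>k. q ^ (k choose 2) * y ^ k) summable_on UNIV" if "y > 0" for y :: real
    using summable_theta_sum_nat[OF assms(1,2) that] assms that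
    by (subst summable_on_UNIV_nonneg_real_iff) auto
  have tri: "int k * (int k - 1) div 2 = int (k choose 2)" for k
    using triangular_int_add[of 0 k] by simp
  have "?f summable_on range int"
    using nat[of "\<bar>x\<bar>"] assms
    by (subst summable_on_reindex) (auto simp: o_def tri abs_mult power_int_abs power_abs)
  moreover have "?f summable_on range (\<lambda>k. - int k)"
  proof -
    \<comment> \<open>The extra \<open>k\<close> in the exponent turns the negative half into the
      one-sided series at \<open>q / \<bar>x\<bar>\<close>.\<close>
    have "- int k * (- int k - 1) div 2 = int (k choose 2) + int k" for k
      using triangular_int_add[of 0 "Suc k"] by (simp add: numeral_2_eq_2 algebra_simps)
    then have "?f (- int k) = q ^ (k choose 2) * (q / \<bar>x\<bar>) ^ k" for k
      using assms by (simp add: abs_mult power_int_minus power_int_add power_divide power_abs field_simps)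
    then show ?thesis using nat[of "q / \<bar>x\<bar>"] assms
      by (subst summable_on_reindex) (auto simp: o_def inj_on_def)
  qed
  ultimately have "?f summable_on (range int \<union> range (\<lambda>k. - int k))"
    by (rule summable_on_union)
  moreover have "range int \<union> range (\<lambda>k. - int k) = UNIV"
    by (auto simp: image_iff) (metis int_cases2)
  ultimately show ?thesis by simp
qed

text \<open>\<open>infsetsum\<close> is an integral for the counting measure, so Lebesgue's theorem
  applies there and its conclusion is carried back to \<open>infsum\<close>.\<close>

lemma infsum_dominated_convergence:
  fixes f :: "nat \<Rightarrow> 'a \<Rightarrow> real"
  assumes "\<And>j. j \<in> A \<Longrightarrow> (\<lambda>n. f n j) \<longlonglongrightarrow> g j"
    and bound: "\<And>n j. j \<in> A \<Longrightarrow> \<bar>f n j\<bar> \<le> h j" and h: "h summable_on A"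
  shows "(\<lambda>n. infsum (f n) A) \<longlonglongrightarrow> infsum g A"
proof -
  have abs: "Infinite_Set_Sum.abs_summable_on u A" if "\<And>j. j \<in> A \<Longrightarrow> \<bar>u j\<bar> \<le> h j" for u :: "'a \<Rightarrow> real"
    using Infinite_Sum.abs_summable_on_comparison_test'[OF h, of u] that by (simp flip: abs_summable_equivalent)
  have g: "\<bar>g j\<bar> \<le> h j" if "j \<in> A" for j
    by (rule tendsto_upperbound[OF tendsto_rabs[OF assms(1)[OF that]]]) (auto simp: bound that)
  have "h j \<ge> 0" if "j \<in> A" for j using bound[OF that, of 0] by linarith
  then have "Infinite_Set_Sum.abs_summable_on h A" by (intro abs) simp
  then have "(\<lambda>n. infsetsum (f n) A) \<longlonglongrightarrow> infsetsum g A"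
    unfolding infsetsum_def abs_summable_on_def
    by (intro integral_dominated_convergence[where w = h]) (auto simp: assms AE_count_space)
  then show ?thesis using abs[OF g] abs[OF bound] by (simp add: infsetsum_infsum)
qed

text \<open>Let \<open>n\<close> tend to infinity in the finite version. Each Gaussian binomial
  tends to \<open>1 / E\<close>, and dominated convergence permits the limit under the sum.\<close>

theorem jacobi_triple_product:
  assumes q: "0 < q" "q < 1" and x: "x \<noteq> 0"
  shows "qpoch q q * qtheta (- x) q = theta_sum x q"
proof -
  define E where "E = qpoch q q"
  define F where "F n = (\<Prod>k<n. 1 - q * q ^ k)" for n
  define t where "t j = q powi (j * (j - 1) div 2) * x powi j" for j :: int
  have F_lim: "F \<longlonglongrightarrow> E" unfolding F_def E_def by (rule qpoch_LIMSEQ[OF q])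
  have "q * q ^ k < 1" for k using q by (simp add: power_Suc_less_one flip: power_Suc)
  then have factor: "0 < 1 - q * q ^ k" "1 - q * q ^ k \<le> 1" for k using q by (auto simp: less_imp_neq)
  have F_pos: "0 < F n" and F_le: "F n \<le> 1" for n
    unfolding F_def using factor by (auto intro!: prod_pos prod_le_1 simp: less_imp_le)
  have "decseq F" unfolding decseq_Suc_iff F_def using factor F_pos
    by (auto simp: F_def intro!: mult_left_le less_imp_le)
  then have F_ge: "E \<le> F n" for n using F_lim by (rule decseq_ge)
  have "E \<noteq> 0" unfolding E_def using \<open>\<And>k. q * q ^ k < 1\<close>
    by (intro qpoch_nonzero q) (auto dest: less_imp_neq)
  moreover have "E \<ge> 0" using F_lim F_pos by (intro tendsto_lowerbound[OF F_lim]) (auto simp: less_imp_le)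
  ultimately have E: "E > 0" by simp
  \<comment> \<open>Extension by 0 puts all the finite sums over the common index set
    \<open>UNIV\<close>.\<close>
  define f where "f n j = (if j \<in> {-int n..int n} then t j * qbinomial q (2 * n) (nat (j + int n)) else 0)" for n j
  have qbin: "qbinomial q (2 * n) (nat (j + int n)) = F (2 * n) / (F (nat (int n + j)) * F (nat (int n - j)))"
    if "j \<in> {-int n..int n}" for n j
  proof -
    have "2 * n - nat (j + int n) = nat (int n - j)" using that by auto
    then show ?thesis
      using qbinomial_fact[of "nat (j + int n)" "2 * n" q] that F_pos[of "nat (int n + j)"] F_pos[of "nat (int n - j)"]
      by (auto simp: F_def[symmetric] field_simps)
  qed
  have lim: "(\<lambda>n. infsum (f n) UNIV) \<longlonglongrightarrow> infsum (\<lambda>j. t j * (E / (E * E))) UNIV"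
  proof (rule infsum_dominated_convergence[where h = "\<lambda>j. \<bar>t j\<bar> * (1 / (E * E))"])
    fix j :: int
    have "(\<lambda>n. F (2 * n)) \<longlonglongrightarrow> E"
      by (rule filterlim_compose[OF F_lim mult_nat_left_at_top]) simp
    moreover have "(\<lambda>n. F (nat (int n + i))) \<longlonglongrightarrow> E" for i
    proof (rule filterlim_compose[OF F_lim])
      show "filterlim (\<lambda>n. nat (int n + i)) sequentially sequentially"
        unfolding filterlim_at_top eventually_sequentially
      proof
        fix Z
        show "\<exists>N. \<forall>n\<ge>N. Z \<le> nat (int n + i)" by (intro exI[of _ "Z + nat (- i)"]) linarith
      qed
    qed
    from this[of j] this[of "- j"] have "(\<lambda>n. F (nat (int n + j))) \<longlonglongrightarrow> E" "(\<lambda>n. F (nat (int n - j))) \<longlonglongrightarrow> E"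
      by simp_all
    ultimately have "(\<lambda>n. t j * (F (2 * n) / (F (nat (int n + j)) * F (nat (int n - j))))) \<longlonglongrightarrow> t j * (E / (E * E))"
      using E by (intro tendsto_intros) auto
    moreover have "eventually (\<lambda>n. t j * (F (2 * n) / (F (nat (int n + j)) * F (nat (int n - j)))) = f n j) sequentially"
      using eventually_ge_at_top[of "nat \<bar>j\<bar>"]
      by eventually_elim (auto simp: f_def qbin)
    ultimately show "(\<lambda>n. f n j) \<longlonglongrightarrow> t j * (E / (E * E))"
      by (rule Lim_transform_eventually)
  next
    fix n and j :: int
    \<comment> \<open>The numerator is at most 1 and both factors of the denominator are at least
      \<open>E\<close>, as \<open>F\<close> decreases to \<open>E\<close>. The bound is uniform in
      \<open>n\<close> and \<open>j\<close>.\<close>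
    have "\<bar>F (2 * n) / (F (nat (int n + j)) * F (nat (int n - j)))\<bar> \<le> 1 / (E * E)"
      using F_pos F_le F_ge E by (simp add: abs_mult) (intro frac_le mult_mono; simp add: less_imp_le)
    then show "\<bar>f n j\<bar> \<le> \<bar>t j\<bar> * (1 / (E * E))"
      unfolding f_def using qbin[of j n] E by (auto simp only: abs_mult if_True intro!: mult_left_mono split: if_splits) auto
  next
    show "(\<lambda>j. \<bar>t j\<bar> * (1 / (E * E))) summable_on UNIV"
      unfolding t_def by (intro summable_on_cmult_left summable_on_theta_sum_abs q x)
  qed
  have infsum_f: "infsum (f n) UNIV = (\<Prod>k<n. 1 - (- x) * q ^ k) * (\<Prod>k<n. 1 - (q / - x) * q ^ k)" for n
  proof -
    have "infsum (f n) UNIV = infsum (\<lambda>j. t j * qbinomial q (2 * n) (nat (j + int n))) {-int n..int n}"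
      by (rule infsum_cong_neutral) (auto simp: f_def)
    also have "\<dots> = (\<Prod>k<n. 1 + x * q ^ k) * (\<Prod>k<n. 1 + q / x * q ^ k)"
      using finite_jacobi_triple_product[of q x n] q x by (simp add: t_def)
    finally show ?thesis by simp
  qed
  have "(\<lambda>n. (\<Prod>k<n. 1 - (- x) * q ^ k) * (\<Prod>k<n. 1 - (q / - x) * q ^ k)) \<longlonglongrightarrow> qtheta (- x) q"
    unfolding qtheta_def by (intro tendsto_mult qpoch_LIMSEQ q)
  from LIMSEQ_unique[OF this lim[unfolded infsum_f]]
  have "qtheta (- x) q = infsum (\<lambda>j. t j * (E / (E * E))) UNIV" .
  also have "\<dots> = theta_sum x q / E"
    using E by (subst infsum_cmult_left') (simp add: theta_sum_def t_def[abs_def])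
  finally show ?thesis using E by (simp add: E_def)
qed

section \<open>The three-term relation\<close>

text \<open>For real families summability is absolute, so the product family is summable on
  \<open>A \<times> B\<close> and its sum can be computed iteratively.\<close>

lemma has_sum_mult_Times:
  fixes f :: "'a \<Rightarrow> real" and g :: "'b \<Rightarrow> real"
  assumes f: "(f has_sum a) A" and g: "(g has_sum b) B"
  shows "((\<lambda>(i, j). f i * g j) has_sum a * b) (A \<times> B)"
proof (rule has_sum_SigmaI)
  show "((\<lambda>j. case (i, j) of (i, j) \<Rightarrow> f i * g j) has_sum f i * b) B" for i
    using has_sum_cmult_right[OF g, of "f i"] by simp
  show "((\<lambda>i. f i * b) has_sum a * b) A" by (rule has_sum_cmult_left[OF f])
  have abs: "(\<lambda>i. norm (f i)) summable_on A" "(\<lambda>j. norm (g j)) summable_on B"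
    using has_sum_imp_summable[OF f] has_sum_imp_summable[OF g]
      summable_on_iff_abs_summable_on_real by blast+
  have inner: "(\<lambda>j. norm (f i * g j)) summable_on B" for i
    using summable_on_cmult_right[OF abs(2), of "norm (f i)"] by (simp only: norm_mult)
  have "infsum (\<lambda>j. norm (f i * g j)) B = norm (f i) * infsum (\<lambda>j. norm (g j)) B" for i
    by (simp only: norm_mult infsum_cmult_right')
  then have "(\<lambda>i. norm (infsum (\<lambda>j. norm (f i * g j)) B)) summable_on A"
    using summable_on_cmult_left[OF abs(1)] by (simp only: norm_mult real_norm_def abs_mult abs_abs)
  with inner have "Infinite_Sum.abs_summable_on (\<lambda>(i, j). f i * g j) (A \<times> B)"
    unfolding Infinite_Sum.abs_summable_on_Sigma_iff prod.case by blast
  then show "(\<lambda>(i, j). f i * g j) summable_on A \<times> B"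
    by (rule Infinite_Sum.abs_summable_summable)
qed

lemma has_sum_theta_sum:
  assumes "0 < q" "q < 1" "x \<noteq> 0"
  shows "((\<lambda>j::int. q powi (j * (j - 1) div 2) * x powi j) has_sum theta_sum x q) UNIV"
  unfolding theta_sum_def using summable_on_theta_sum_abs[OF assms]
  by (metis (no_types, lifting) has_sum_infsum real_norm_def summable_on_cong summable_on_iff_abs_summable_on_real)

text \<open>Index pairs with even sum are \<open>(r + s, r - s)\<close>, those with odd sum
  \<open>(r + s, r - s + 1)\<close>. These substitutions turn the quadratic exponent into
  \<open>r * (r - 1) + s * s\<close> and \<open>r * r + s * (s - 1)\<close> respectively, so the
  variables separate and each class factors.\<close>

lemma theta_sum_mult:
  assumes q: "0 < q" "q < 1" and x: "x \<noteq> 0" and y: "y \<noteq> 0"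
  shows "theta_sum (- (x * y)) q * theta_sum (- (x / y)) q =
    theta_sum (x\<^sup>2) (q\<^sup>2) * theta_sum (q * y\<^sup>2) (q\<^sup>2)
    - x / y * (theta_sum (q * x\<^sup>2) (q\<^sup>2) * theta_sum (y\<^sup>2) (q\<^sup>2))"
proof -
  define t where "t x q j = q powi (j * (j - 1) div 2) * x powi j" for x q :: real and j :: int
  have t: "(t x q has_sum theta_sum x q) UNIV" if "0 < q" "q < 1" "x \<noteq> 0" for x q
    unfolding t_def by (rule has_sum_theta_sum[OF that])
  define F where "F = (\<lambda>(m, n). t (- (x * y)) q m * t (- (x / y)) q n)"
  have q2: "0 < q\<^sup>2" "q\<^sup>2 < 1" using q by (auto simp: power_less_one_iff)
  have sq: "(z\<^sup>2) powi k = z powi (2 * k)" for z :: real and k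
    by (simp add: power_int_mult)
  have F_eq: "F (m, n) = q powi (m * (m - 1) div 2 + n * (n - 1) div 2) * (-1) powi (m + n)
      * x powi (m + n) * y powi (m - n)" for m n
  proof -
    have "- (x * y) = (-1) * (x * y)" "- (x / y) = (-1) * (x / y)" by simp_all
    then show ?thesis using q x y
      unfolding F_def t_def prod.case
      by (simp only: power_int_mult_distrib power_int_divide_distrib) (simp add: power_int_add power_int_diff)
  qed
  have tri: "2 * (j * (j - 1) div 2) = j * (j - 1)" for j :: int by simp
  have tA: "t (z\<^sup>2) (q\<^sup>2) j = q powi (j * (j - 1)) * z powi (2 * j)" for z j
    unfolding t_def sq tri ..
  have tB: "t (q * z\<^sup>2) (q\<^sup>2) j = q powi (j * j) * z powi (2 * j)" for z j
  proof -
    have "q powi (j * j) = q powi (j * (j - 1)) * q powi j"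
      using q by (simp flip: power_int_add add: algebra_simps)
    then show ?thesis unfolding t_def power_int_mult_distrib sq tri by simp
  qed
  have even: "F (r + s, r - s) = t (x\<^sup>2) (q\<^sup>2) r * t (q * y\<^sup>2) (q\<^sup>2) s" for r s
  proof -
    have "2 * ((r + s) * (r + s - 1) div 2 + (r - s) * (r - s - 1) div 2) = 2 * (r * (r - 1) + s * s)"
      unfolding distrib_left tri by (simp add: algebra_simps)
    then have "(r + s) * (r + s - 1) div 2 + (r - s) * (r - s - 1) div 2 = r * (r - 1) + s * s"
      by (rule mult_left_cancel[THEN iffD1, rotated]) simp
    then show ?thesis using q unfolding F_eq tA tB by (simp add: power_int_add)
  qed
  \<comment> \<open>The sum of the indices is \<open>2 * r + 1\<close> and their difference
    \<open>2 * s - 1\<close>: this yields the sign and the factor \<open>x / y\<close>.\<close>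
  have odd: "F (r + s, r - s + 1) = - (x / y) * (t (q * x\<^sup>2) (q\<^sup>2) r * t (y\<^sup>2) (q\<^sup>2) s)" for r s
  proof -
    have "2 * ((r + s) * (r + s - 1) div 2 + (r - s + 1) * (r - s + 1 - 1) div 2) = 2 * (r * r + s * (s - 1))"
      unfolding distrib_left tri by (simp add: algebra_simps)
    then have "(r + s) * (r + s - 1) div 2 + (r - s + 1) * (r - s + 1 - 1) div 2 = r * r + s * (s - 1)"
      by (rule mult_left_cancel[THEN iffD1, rotated]) simp
    moreover have "r + s + (r - s + 1) = 2 * r + 1" "r + s - (r - s + 1) = 2 * s - 1" by simp_all
    moreover have "y powi (2 * s - 1) = y powi (2 * s) / y" using y by (simp add: power_int_diff)
    moreover have "x powi (2 * r + 1) = x powi (2 * r) * x" using x by (simp add: power_int_add)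
    moreover have "(-1 :: real) powi (2 * r + 1) = - 1" by (simp add: power_int_add)
    moreover have "q powi (r * r + s * (s - 1)) = q powi (r * r) * q powi (s * (s - 1))"
      using q by (simp add: power_int_add)
    ultimately show ?thesis unfolding F_eq tA tB by simp
  qed
  let ?e = "theta_sum (x\<^sup>2) (q\<^sup>2) * theta_sum (q * y\<^sup>2) (q\<^sup>2)"
  let ?o = "- (x / y) * (theta_sum (q * x\<^sup>2) (q\<^sup>2) * theta_sum (y\<^sup>2) (q\<^sup>2))"
  have "(F has_sum ?e) {(m, n). even (m + n)}"
  proof -
    have "((\<lambda>(r, s). t (x\<^sup>2) (q\<^sup>2) r * t (q * y\<^sup>2) (q\<^sup>2) s) has_sum ?e) (UNIV \<times> UNIV)"
      using q q2 x y by (intro has_sum_mult_Times t) auto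
    also have "?this \<longleftrightarrow> ?thesis"
      by (rule has_sum_reindex_bij_witness[of _ "\<lambda>(m, n). ((m + n) div 2, m - (m + n) div 2)" "\<lambda>(r, s). (r + s, r - s)"])
         (auto simp: even)
    finally show ?thesis .
  qed
  moreover have "(F has_sum ?o) {(m, n). odd (m + n)}"
  proof -
    have "((\<lambda>(r, s). t (q * x\<^sup>2) (q\<^sup>2) r * t (y\<^sup>2) (q\<^sup>2) s) has_sum
        (theta_sum (q * x\<^sup>2) (q\<^sup>2) * theta_sum (y\<^sup>2) (q\<^sup>2))) (UNIV \<times> UNIV)"
      using q q2 x y by (intro has_sum_mult_Times t) auto
    from has_sum_cmult_right[OF this, of "- (x / y)"]
    have "((\<lambda>(r, s). - (x / y) * (t (q * x\<^sup>2) (q\<^sup>2) r * t (y\<^sup>2) (q\<^sup>2) s)) has_sum ?o) (UNIV \<times> UNIV)"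
      by (simp add: case_prod_unfold)
    also have "?this \<longleftrightarrow> ?thesis"
    proof (rule has_sum_reindex_bij_witness[of _ "\<lambda>(m, n). ((m + n - 1) div 2, m - (m + n - 1) div 2)"
          "\<lambda>(r, s). (r + s, r - s + 1)"], goal_cases)
      case (3 b)
      obtain m n where b: "b = (m, n)" by fastforce
      with 3 have "odd (m + n)" by simp
      then obtain k where "m + n = 2 * k + 1" by (rule oddE)
      then have "n = 2 * k + 1 - m" by simp
      with b show ?case by simp
    qed (auto simp: odd)
    finally show ?thesis .
  qed
  ultimately have "(F has_sum (?e + ?o)) ({(m, n). even (m + n)} \<union> {(m, n). odd (m + n)})"
    by (rule has_sum_Un_disjoint) auto
  moreover have "{(m, n). even (m + n)} \<union> {(m, n). odd (m + n)} = (UNIV :: (int \<times> int) set)" by auto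
  moreover have "(F has_sum (theta_sum (- (x * y)) q * theta_sum (- (x / y)) q)) (UNIV \<times> UNIV)"
    unfolding F_def using q x y by (intro has_sum_mult_Times t) auto
  ultimately show ?thesis using has_sum_unique by fastforce
qed

text \<open>Up to \<open>E\<^sup>2\<close>, the product at \<open>x * y\<close> and
  \<open>x / y\<close> is \<open>1 / y\<close> times the minor of the vectors
  \<open>(A x, x * B x)\<close> and \<open>(A y, y * B y)\<close>. The weights \<open>y\<close>,
  \<open>u\<close>, \<open>u\<close> give all three terms the common factor \<open>1 / v\<close>,
  leaving the Pluecker relation.\<close>

theorem weierstrass_three_term:
  assumes q: "0 < q" "q < 1" and nz: "x \<noteq> 0" "y \<noteq> 0" "u \<noteq> 0" "v \<noteq> 0"
  shows "y * (qtheta (x * y) q * qtheta (x / y) q * (qtheta (u * v) q * qtheta (u / v) q))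
    - u * (qtheta (x * u) q * qtheta (x / u) q * (qtheta (y * v) q * qtheta (y / v) q))
    + u * (qtheta (x * v) q * qtheta (x / v) q * (qtheta (y * u) q * qtheta (y / u) q)) = 0"
proof -
  define E where "E = qpoch q q"
  define A where "A z = theta_sum (z\<^sup>2) (q\<^sup>2)" for z
  define B where "B z = theta_sum (q * z\<^sup>2) (q\<^sup>2)" for z
  have "q * q ^ k \<noteq> 1" for k
    using q power_Suc_less_one[of q k] by (simp add: less_imp_neq)
  then have E: "E \<noteq> 0" unfolding E_def by (intro qpoch_nonzero q)
  have D: "qtheta (x * y) q * qtheta (x / y) q = (A x * B y - x / y * (B x * A y)) / E\<^sup>2"
    if "x \<noteq> 0" "y \<noteq> 0" for x y
  proof -
    have "theta_sum (- (x * y)) q = E * qtheta (x * y) q" "theta_sum (- (x / y)) q = E * qtheta (x / y) q"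
      using jacobi_triple_product[OF q, of "- (x * y)"] jacobi_triple_product[OF q, of "- (x / y)"] that
      by (simp_all add: E_def)
    with theta_sum_mult[OF q that]
    have "(E * qtheta (x * y) q) * (E * qtheta (x / y) q) = A x * B y - x / y * (B x * A y)"
      by (simp only: A_def B_def)
    then show ?thesis using E by (simp add: eq_divide_eq power2_eq_square mult_ac)
  qed
  show ?thesis
    unfolding D[OF nz(1,2)] D[OF nz(3,4)] D[OF nz(1,3)] D[OF nz(2,4)] D[OF nz(1,4)] D[OF nz(2,3)]
    using nz E by (simp add: field_simps)
qed

section \<open>Theta functions at powers of q\<close>

lemma qtheta_mult_minus:
  assumes "0 < q" "q < 1"
  shows "qtheta x q * qtheta (- x) q = qtheta (x\<^sup>2) (q\<^sup>2)"
  using qpoch_mult_minus[OF assms, of x] qpoch_mult_minus[OF assms, of "q / x"]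
  by (simp add: qtheta_def power_divide mult_ac)

lemma qtheta_dissect:
  assumes "0 < q" "q < 1" "x \<noteq> 0"
  shows "qtheta x q = qtheta x (q\<^sup>2) * qtheta (x * q) (q\<^sup>2)"
  using qpoch_dissect[OF assms(1,2), of x] qpoch_dissect[OF assms(1,2), of "q / x"] assms
  by (simp add: qtheta_def power2_eq_square mult_ac)

lemma qtheta_reflect:
  assumes "q \<noteq> 0" "x \<noteq> 0"
  shows "qtheta (q / x) q = qtheta x q"
  using assms by (simp add: qtheta_def)

lemma qtheta_power_reflect:
  fixes q :: real
  assumes "q \<noteq> 0" "n \<le> M"
  shows "qtheta (q ^ (M - n)) (q ^ M) = qtheta (q ^ n) (q ^ M)"
  using qtheta_reflect[of "q ^ M" "q ^ n"] assms by (simp add: power_diff)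

text \<open>A factor could vanish only if a positive power of \<open>q\<close> were 1: both
  \<open>q ^ n\<close> and \<open>q ^ M / q ^ n = q ^ (M - n)\<close> have positive
  exponents.\<close>

lemma qtheta_power_nonzero:
  fixes q :: real
  assumes "0 < q" "q < 1" "0 < n" "n < M"
  shows "qtheta (q ^ n) (q ^ M) \<noteq> 0"
proof -
  have M: "0 < q ^ M" "q ^ M < 1" using assms by (auto simp: power_less_one_iff)
  have ne: "q ^ i * (q ^ M) ^ k \<noteq> 1" if "0 < i" for i k
  proof -
    have "q ^ i * (q ^ M) ^ k = q ^ (i + M * k)" by (simp add: power_add power_mult)
    also have "\<dots> < 1" using assms that by (simp add: power_less_one_iff)
    finally show ?thesis by simp
  qed
  have "q ^ M / q ^ n = q ^ (M - n)" using assms by (simp add: power_diff)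
  then show ?thesis
    unfolding qtheta_def using ne assms M by (simp add: qpoch_nonzero)
qed

text \<open>Dissection gives the arguments \<open>q ^ n\<close> and \<open>q ^ (n + M)\<close> for
  the base \<open>q ^ (2 * M)\<close>; reflection replaces the latter by
  \<open>q ^ (M - n)\<close>.\<close>

lemma qtheta_power_half:
  fixes q :: real
  assumes "0 < q" "q < 1" "0 < n" "n < M"
  shows "qtheta (q ^ n) (q ^ M) = qtheta (q ^ n) (q ^ (2 * M)) * qtheta (q ^ (M - n)) (q ^ (2 * M))"
proof -
  have M: "0 < q ^ M" "q ^ M < 1" using assms by (auto simp: power_less_one_iff)
  have "qtheta (q ^ n * q ^ M) ((q ^ M)\<^sup>2) = qtheta (q ^ (M - n)) (q ^ (2 * M))"
    using qtheta_power_reflect[of q "M - n" "2 * M"] assms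
    by (simp add: add.commute flip: power_add power_mult mult_2_right) (simp add: mult.commute)
  then show ?thesis
    using qtheta_dissect[OF M, of "q ^ n"] assms by (simp add: mult.commute flip: power_mult)
qed

text \<open>The product of the values at \<open>x\<close> and \<open>- x\<close> is the value at the
  squared argument and squared base; divide it by the factorization of the value at
  \<open>x = q ^ n\<close>.\<close>

lemma qtheta_minus_power:
  fixes q :: real
  assumes "0 < q" "q < 1" "0 < n" "n < M"
  shows "qtheta (- (q ^ n)) (q ^ M) = qtheta (q ^ (2 * n)) (q ^ (2 * M)) /
    (qtheta (q ^ n) (q ^ (2 * M)) * qtheta (q ^ (M - n)) (q ^ (2 * M)))"
proof -
  have M: "0 < q ^ M" "q ^ M < 1" using assms by (auto simp: power_less_one_iff)
  have "qtheta (q ^ n) (q ^ M) * qtheta (- (q ^ n)) (q ^ M) = qtheta (q ^ (2 * n)) (q ^ (2 * M))"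
    using qtheta_mult_minus[OF M, of "q ^ n"] by (simp add: mult.commute flip: power_mult)
  then show ?thesis
    using qtheta_power_nonzero[OF assms] unfolding qtheta_power_half[OF assms]
    by (simp add: field_simps)
qed

text \<open>The letters p (plus) and m (minus) in the next two names are the signs of the four points
  \<open>x, y, u, v\<close>, which are \<open>q\<^sup>a, q\<^sup>b, q\<^sup>c, q\<^sup>d\<close> up to sign.\<close>

lemma weierstrass_pmmp:
  fixes q :: real
  assumes q: "0 < q" "q < 1" and M: "0 < M" and "d < c" "c < b" "b < a"
  defines "T \<equiv> \<lambda>n. qtheta (q ^ n) (q ^ M)" and "S \<equiv> \<lambda>n. qtheta (- (q ^ n)) (q ^ M)"
  shows "S (a + c) * S (a - c) * (S (b + d) * S (b - d)) -
    q ^ (b - c) * (S (a + b) * S (a - b) * (S (c + d) * S (c - d))) =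
    T (a + d) * T (a - d) * (T (b + c) * T (b - c))"
proof -
  have QM: "0 < q ^ M" "q ^ M < 1" using q M by (auto simp: power_less_one_iff)
  have div: "q ^ i / q ^ j = q ^ (i - j)" if "j < i" for i j
    using q that by (simp add: power_diff)
  have qb: "q ^ b = q ^ c * q ^ (b - c)" using assms by (simp flip: power_add)
  \<comment> \<open>A product or quotient of two of the points is negative exactly when their signs
    differ, which yields \<open>S\<close>; equal signs yield \<open>T\<close>. The ordering of the
    exponents makes every quotient a positive power of \<open>q\<close> up to sign.\<close>
  have "- (q ^ b) * (S (a + b) * S (a - b) * (S (c + d) * S (c - d)))
      + q ^ c * (S (a + c) * S (a - c) * (S (b + d) * S (b - d)))
      - q ^ c * (T (a + d) * T (a - d) * (T (b + c) * T (b - c))) = 0"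
    using weierstrass_three_term[OF QM, of "q ^ a" "- (q ^ b)" "- (q ^ c)" "q ^ d"] assms(1,4-6)
    by (simp add: S_def T_def div power_add[symmetric])
  then have "q ^ c * (S (a + c) * S (a - c) * (S (b + d) * S (b - d)) -
      q ^ (b - c) * (S (a + b) * S (a - b) * (S (c + d) * S (c - d)))) =
    q ^ c * (T (a + d) * T (a - d) * (T (b + c) * T (b - c)))"
    unfolding qb by (simp add: right_diff_distrib mult.assoc)
  then show ?thesis using q by simp
qed

lemma weierstrass_mpmp:
  fixes q :: real
  assumes q: "0 < q" "q < 1" and M: "0 < M" and "d < c" "c < b" "b < a"
  defines "T \<equiv> \<lambda>n. qtheta (q ^ n) (q ^ M)" and "S \<equiv> \<lambda>n. qtheta (- (q ^ n)) (q ^ M)"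
  shows "S (a + d) * S (a - d) * (S (b + c) * S (b - c)) -
    q ^ (b - c) * (S (a + b) * S (a - b) * (S (c + d) * S (c - d))) =
    T (a + c) * T (a - c) * (T (b + d) * T (b - d))"
proof -
  have QM: "0 < q ^ M" "q ^ M < 1" using q M by (auto simp: power_less_one_iff)
  have div: "q ^ i / q ^ j = q ^ (i - j)" if "j < i" for i j
    using q that by (simp add: power_diff)
  have qb: "q ^ b = q ^ c * q ^ (b - c)" using assms by (simp flip: power_add)
  have "q ^ b * (S (a + b) * S (a - b) * (S (c + d) * S (c - d)))
      + q ^ c * (T (a + c) * T (a - c) * (T (b + d) * T (b - d)))
      - q ^ c * (S (a + d) * S (a - d) * (S (b + c) * S (b - c))) = 0"
    using weierstrass_three_term[OF QM, of "- (q ^ a)" "q ^ b" "- (q ^ c)" "q ^ d"] assms(1,4-6)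
    by (simp add: S_def T_def div power_add[symmetric])
  then have "q ^ c * (S (a + d) * S (a - d) * (S (b + c) * S (b - c)) -
      q ^ (b - c) * (S (a + b) * S (a - b) * (S (c + d) * S (c - d)))) =
    q ^ c * (T (a + c) * T (a - c) * (T (b + d) * T (b - d)))"
    unfolding qb by (simp add: right_diff_distrib mult.assoc)
  then show ?thesis using q by simp
qed

section \<open>Partitions with parts in residue classes\<close>

lemma mem_pm_residues_iff:
  assumes "\<And>r. r \<in> R \<Longrightarrow> 0 < r \<and> r < M"
  shows "n \<in> pm_residues (int ` R) (int M) \<longleftrightarrow> n mod M \<in> R \<or> M - n mod M \<in> R"
proof -
  have plus: "[int n = int r] (mod int M) \<longleftrightarrow> n mod M = r" if "r \<in> R" for r
    using assms[OF that] by (simp only: cong_int_iff) (simp add: Cong.cong_def)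
  have minus: "[int n = - int r] (mod int M) \<longleftrightarrow> M - n mod M = r" if "r \<in> R" for r
  proof -
    have r: "0 < r" "r < M" using assms[OF that] by auto
    have "[int n = - int r] (mod int M) \<longleftrightarrow> int M dvd int (n + r)"
      by (simp add: cong_iff_dvd_diff)
    also have "\<dots> \<longleftrightarrow> M dvd n mod M + r"
      by (metis int_dvd_int_iff dvd_eq_mod_eq_0 mod_add_left_eq)
    \<comment> \<open>The sum lies strictly between 0 and \<open>2 * M\<close>, so \<open>M\<close>
      is its only possible value divisible by \<open>M\<close>.\<close>
    also have "\<dots> \<longleftrightarrow> n mod M + r = M"
    proof
      assume "M dvd n mod M + r"
      then obtain k where k: "n mod M + r = M * k" by (elim dvdE)
      have "n mod M < M" using r by simp
      with k r have "M * k < M * 2" "0 < M * k" by linarith+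
      then have "k < 2" "0 < k" by simp_all
      then have "k = 1" by simp
      with k show "n mod M + r = M" by simp
    qed simp
    also have "\<dots> \<longleftrightarrow> M - n mod M = r"
      using r mod_less_divisor[of M n] by linarith
    finally show ?thesis .
  qed
  have "n > 0" if "n mod M \<in> R \<or> M - n mod M \<in> R"
    using that assms by (cases "n = 0") auto
  then show ?thesis using plus minus by (auto simp: pm_residues_def)
qed

text \<open>Induction over blocks of \<open>M\<close> consecutive integers: the block starting at
  \<open>M * N\<close> contributes \<open>M * N + r\<close> and \<open>M * N + (M - r)\<close> for
  each \<open>r\<close> in \<open>R\<close>.\<close>

lemma prod_pm_residues:
  fixes q :: real
  assumes q: "q \<noteq> 0" and R: "finite R" "\<And>r. r \<in> R \<Longrightarrow> 0 < r \<and> 2 * r < M"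
  shows "(\<Prod>m\<in>pm_residues (int ` R) (int M) \<inter> {..<M * N}. 1 - q ^ m) =
    (\<Prod>r\<in>R. (\<Prod>k<N. 1 - q ^ r * (q ^ M) ^ k) * (\<Prod>k<N. 1 - q ^ M / q ^ r * (q ^ M) ^ k))"
proof (induction N)
  case (Suc N)
  let ?S = "pm_residues (int ` R) (int M)"
  have mem: "n \<in> ?S \<longleftrightarrow> n mod M \<in> R \<or> M - n mod M \<in> R" for n
    using R(2) by (intro mem_pm_residues_iff) force
  let ?A = "(\<lambda>r. M * N + r) ` R" and ?B = "(\<lambda>r. M * N + (M - r)) ` R"
  have "?S \<inter> {..<M * Suc N} = (?S \<inter> {..<M * N}) \<union> (?A \<union> ?B)"
  proof (intro equalityI subsetI)
    fix n assume n: "n \<in> ?S \<inter> {..<M * Suc N}"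
    show "n \<in> (?S \<inter> {..<M * N}) \<union> (?A \<union> ?B)"
    proof (cases "n < M * N")
      case False
      define i where "i = n - M * N"
      have i: "n = M * N + i" "i < M" using False n by (auto simp: i_def)
      then consider "i \<in> R" | "M - i \<in> R" using n by (auto simp: mem)
      then show ?thesis
      proof cases
        case 2
        moreover have "n = M * N + (M - (M - i))" using i by simp
        ultimately show ?thesis by blast
      qed (use i in blast)
    qed (use n in auto)
  next
    fix n assume n: "n \<in> (?S \<inter> {..<M * N}) \<union> (?A \<union> ?B)"
    show "n \<in> ?S \<inter> {..<M * Suc N}"
      using n R(2) by (fastforce simp: mem)
  qed
  moreover have "(?S \<inter> {..<M * N}) \<inter> (?A \<union> ?B) = {}" by auto
  \<comment> \<open>The strict bound \<open>2 * r < M\<close> keeps \<open>r\<close> and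
    \<open>M - s\<close> apart, so no part is counted twice.\<close>
  moreover have "?A \<inter> ?B = {}"
  proof -
    have "r \<noteq> M - s" if "r \<in> R" "s \<in> R" for r s using R(2)[OF that(1)] R(2)[OF that(2)] by linarith
    then show ?thesis by auto
  qed
  moreover have "(\<Prod>m\<in>?A. 1 - q ^ m) = (\<Prod>r\<in>R. 1 - q ^ r * (q ^ M) ^ N)"
    by (subst prod.reindex) (auto simp: inj_on_def power_add power_mult mult.commute)
  moreover have "(\<Prod>m\<in>?B. 1 - q ^ m) = (\<Prod>r\<in>R. 1 - q ^ M / q ^ r * (q ^ M) ^ N)"
  proof (subst prod.reindex)
    show "inj_on (\<lambda>r. M * N + (M - r)) R" using R(2) by (force simp: inj_on_def)
    show "prod ((\<lambda>m. 1 - q ^ m) \<circ> (\<lambda>r. M * N + (M - r))) R = (\<Prod>r\<in>R. 1 - q ^ M / q ^ r * (q ^ M) ^ N)"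
    proof (intro prod.cong refl)
      fix r assume "r \<in> R"
      then have "r \<le> M" using R(2) by force
      then show "((\<lambda>m. 1 - q ^ m) \<circ> (\<lambda>r. M * N + (M - r))) r = 1 - q ^ M / q ^ r * (q ^ M) ^ N"
        using q by (simp add: power_add power_mult power_diff mult.commute)
    qed
  qed
  ultimately show ?case
    using R(1) Suc by (simp add: prod.union_disjoint prod.distrib mult_ac)
qed simp

theorem sums_num_partitions_pm_residues:
  fixes q :: real
  assumes q: "0 < q" "q < 1" and R: "finite R" "\<And>r. r \<in> R \<Longrightarrow> 0 < r \<and> 2 * r < M" and M: "0 < M"
  shows "(\<lambda>n. real (num_partitions (pm_residues (int ` R) (int M)) n) * q ^ n) sums
    inverse (\<Prod>r\<in>R. qtheta (q ^ r) (q ^ M))"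
proof (rule sums_num_partitions[OF _ q M])
  have QM: "0 < q ^ M" "q ^ M < 1" using q M by (auto simp: power_less_one_iff)
  have "(\<lambda>N. \<Prod>r\<in>R. (\<Prod>k<N. 1 - q ^ r * (q ^ M) ^ k) * (\<Prod>k<N. 1 - q ^ M / q ^ r * (q ^ M) ^ k))
      \<longlonglongrightarrow> (\<Prod>r\<in>R. qtheta (q ^ r) (q ^ M))"
    unfolding qtheta_def by (intro tendsto_prod tendsto_mult qpoch_LIMSEQ QM)
  then show "(\<lambda>N. \<Prod>m\<in>pm_residues (int ` R) (int M) \<inter> {..<M * N}. 1 - q ^ m)
      \<longlonglongrightarrow> (\<Prod>r\<in>R. qtheta (q ^ r) (q ^ M))"
    using prod_pm_residues[OF _ R] q by simp
  show "(\<Prod>r\<in>R. qtheta (q ^ r) (q ^ M)) \<noteq> 0"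
  proof -
    have "qtheta (q ^ r) (q ^ M) \<noteq> 0" if "r \<in> R" for r
      using R(2)[OF that] by (intro qtheta_power_nonzero q) auto
    then show ?thesis using R(1) by simp
  qed
qed (simp add: pm_residues_def)

text \<open>Compares coefficients in the identity of generating functions. The 1 on its right-hand
  side affects only the coefficient of index 0, which \<open>0 < e \<le> n\<close> excludes.\<close>

lemma num_partitions_shift:
  assumes A: "\<And>r. r \<in> A \<Longrightarrow> 0 < r \<and> 2 * r < M" and B: "\<And>r. r \<in> B \<Longrightarrow> 0 < r \<and> 2 * r < M"
    and fin: "finite A" "finite B" and M: "0 < M" and e: "0 < e"
    and eq: "\<And>q :: real. 0 < q \<Longrightarrow> q < 1 \<Longrightarrow>
      inverse (\<Prod>r\<in>A. qtheta (q ^ r) (q ^ M)) - q ^ e * inverse (\<Prod>r\<in>B. qtheta (q ^ r) (q ^ M)) = 1"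
    and "e \<le> n"
  shows "num_partitions (pm_residues (int ` A) (int M)) n = num_partitions (pm_residues (int ` B) (int M)) (n - e)"
proof -
  define a where "a n = real (num_partitions (pm_residues (int ` A) (int M)) n)" for n
  define b where "b n = real (num_partitions (pm_residues (int ` B) (int M)) n)" for n
  define h where "h n = a n - (if n < e then 0 else b (n - e)) - (if n = 0 then 1 else 0)" for n
  have "(\<lambda>n. h n * q ^ n) sums 0" if q: "0 < q" "q < 1" for q :: real
  proof -
    let ?A = "inverse (\<Prod>r\<in>A. qtheta (q ^ r) (q ^ M))" and ?B = "inverse (\<Prod>r\<in>B. qtheta (q ^ r) (q ^ M))"
    have a: "(\<lambda>n. a n * q ^ n) sums ?A" unfolding a_def
      by (rule sums_num_partitions_pm_residues[OF q fin(1) A M])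
    have b: "(\<lambda>n. b n * q ^ n) sums ?B" unfolding b_def
      by (rule sums_num_partitions_pm_residues[OF q fin(2) B M])
    have "(\<lambda>n. if n < e then 0 else q ^ e * (b (n - e) * q ^ (n - e))) sums (q ^ e * ?B)"
      using sums_mult[OF b, of "q ^ e"]
      by (subst sums_iff_shift'[of _ e, symmetric]) (simp add: sum.neutral)
    moreover have "(\<lambda>n. if n = 0 then (1 :: real) else 0) sums 1"
      using sums_single[of 0 "\<lambda>_. 1 :: real"] by simp
    ultimately have "(\<lambda>n. a n * q ^ n - (if n < e then 0 else q ^ e * (b (n - e) * q ^ (n - e)))
        - (if n = 0 then 1 else 0)) sums (?A - q ^ e * ?B - 1)"
      by (intro sums_diff a)
    moreover have "a n * q ^ n - (if n < e then 0 else q ^ e * (b (n - e) * q ^ (n - e)))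
        - (if n = 0 then 1 else 0) = h n * q ^ n" for n
    proof -
      have "q ^ e * q ^ (n - e) = q ^ n" if "\<not> n < e" using that by (simp flip: power_add)
      then show ?thesis by (auto simp: h_def left_diff_distrib mult.left_commute[of "q ^ e"])
    qed
    ultimately show ?thesis using eq[OF q] by simp
  qed
  then have "h n = 0" by (rule powser_sums_0_imp_coeff_0)
  then show ?thesis using e \<open>e \<le> n\<close> by (simp add: h_def a_def b_def)
qed

section \<open>The four theta identities and the partition theorem\<close>

text \<open>Each identity is a three-term relation for base \<open>q ^ 30\<close> divided by its
  right-hand side. Once all terms are written in \<open>J\<close>, common factors cancel and the two
  quotients on the left are the two reciprocal products.\<close>

lemma theta_identities:
  fixes q :: real
  assumes q: "0 < q" "q < 1"
  defines "J \<equiv> \<lambda>r. qtheta (q ^ r) (q ^ 60)"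
  shows "inverse (\<Prod>r\<in>{1, 3, 4, 5, 7, 22, 23, 24, 25, 26, 27, 29}. J r) -
      q ^ 1 * inverse (\<Prod>r\<in>{1, 2, 3, 7, 11, 19, 23, 24, 26, 27, 28, 29}. J r) = 1" (is ?i)
    and "inverse (\<Prod>r\<in>{2, 7, 9, 11, 12, 13, 14, 16, 17, 19, 21, 23}. J r) -
      q ^ 2 * inverse (\<Prod>r\<in>{2, 5, 7, 9, 11, 12, 19, 21, 23, 25, 26, 28}. J r) = 1" (is ?ii)
    and "inverse (\<Prod>r\<in>{2, 3, 5, 11, 13, 14, 16, 17, 19, 24, 25, 27}. J r) -
      q ^ 2 * inverse (\<Prod>r\<in>{1, 3, 8, 11, 13, 14, 17, 19, 22, 24, 27, 29}. J r) = 1" (is ?iii)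
    and "inverse (\<Prod>r\<in>{1, 5, 8, 9, 12, 13, 14, 17, 21, 22, 25, 29}. J r) -
      q ^ 1 * inverse (\<Prod>r\<in>{1, 4, 7, 9, 12, 13, 17, 21, 22, 23, 26, 29}. J r) = 1" (is ?iv)
proof -
  define T where "T r = qtheta (q ^ r) (q ^ 30)" for r
  define S where "S r = qtheta (- (q ^ r)) (q ^ 30)" for r
  have J: "J r \<noteq> 0" if "0 < r" "r < 60" for r
    unfolding J_def by (rule qtheta_power_nonzero[OF q that])
  have "J (60 - r) = J r" if "r \<le> 60" for r
    unfolding J_def using q that by (intro qtheta_power_reflect) auto
  \<comment> \<open>The values \<open>S 16\<close>, \<open>S 20\<close>, \<open>S 21\<close> and
    \<open>S 22\<close> involve \<open>J (2 * r)\<close> with index above 30, which is reflected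
    back below 30.\<close>
  from this[of 28] this[of 20] this[of 18] this[of 16]
  have reflect: "J 32 = J 28" "J 40 = J 20" "J 42 = J 18" "J 44 = J 16" by simp_all
  have T: "T r = J r * J (30 - r)" if "0 < r" "r < 30" for r
    using qtheta_power_half[OF q that] by (simp add: J_def T_def)
  have S: "S r = J (2 * r) / (J r * J (30 - r))" if "0 < r" "r < 30" for r
    using qtheta_minus_power[OF q that] by (simp add: J_def S_def)
  have divide: "inverse a - q ^ e * inverse b = 1"
    if "s - q ^ e * s' = t" "s = t * inverse a" "s' = t * inverse b" "t \<noteq> 0" for s s' t a b e
  proof -
    have "t * (inverse a - q ^ e * inverse b) = t * 1" using that by (simp add: algebra_simps)
    then show ?thesis using \<open>t \<noteq> 0\<close> by simp
  qed
  note pmmp = weierstrass_pmmp[OF q, of 30, folded T_def S_def]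
  note mpmp = weierstrass_mpmp[OF q, of 30, folded T_def S_def]
  \<comment> \<open>The four instances list the exponents as \<open>d\<close>, \<open>c\<close>,
    \<open>b\<close>, \<open>a\<close>. In each of them \<open>b - c\<close> is the shift in the
    partition identity: 1, 2, 2 and 1.\<close>
  have "S 10 * S 4 * (S 5 * S 3) - q ^ 1 * (S 11 * S 3 * (S 4 * S 2)) = T 8 * T 6 * (T 7 * T 1)"
    using pmmp[of 1 3 4 7] by simp
  then show ?i by (rule divide) (simp_all add: S T J reflect field_simps)
  have "S 13 * S 9 * (S 16 * S 2) - q ^ 2 * (S 20 * S 2 * (S 9 * S 5)) = T 18 * T 4 * (T 11 * T 7)"
    using mpmp[of 2 7 9 11] by simp
  then show ?ii by (rule divide) (simp_all add: S T J reflect field_simps)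
  have "S 14 * S 10 * (S 5 * S 3) - q ^ 2 * (S 16 * S 8 * (S 3 * S 1)) = T 13 * T 11 * (T 6 * T 2)"
    using pmmp[of 1 2 4 12] by simp
  then show ?iii by (rule divide) (simp_all add: S T J reflect field_simps numeral_2_eq_2)
  have "S 21 * S 5 * (S 10 * S 8) - q ^ 1 * (S 22 * S 4 * (S 9 * S 7)) = T 14 * T 12 * (T 17 * T 1)"
    using pmmp[of 1 8 9 13] by simp
  then show ?iv by (rule divide) (simp_all add: S T J reflect field_simps)
qed

theorem theorem12p1:
  shows "(\<forall>n\<ge>1. num_partitions (pm_residues {1, 3, 4, 5, 7, 22, 23, 24, 25, 26, 27, 29} 60) n
        = num_partitions (pm_residues {1, 2, 3, 7, 11, 19, 23, 24, 26, 27, 28, 29} 60) (n - 1)) \<and>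
    (\<forall>n\<ge>2. num_partitions (pm_residues {2, 7, 9, 11, 12, 13, 14, 16, 17, 19, 21, 23} 60) n
        = num_partitions (pm_residues {2, 5, 7, 9, 11, 12, 19, 21, 23, 25, 26, 28} 60) (n - 2)) \<and>
    (\<forall>n\<ge>2. num_partitions (pm_residues {2, 3, 5, 11, 13, 14, 16, 17, 19, 24, 25, 27} 60) n
        = num_partitions (pm_residues {1, 3, 8, 11, 13, 14, 17, 19, 22, 24, 27, 29} 60) (n - 2)) \<and>
    (\<forall>n\<ge>1. num_partitions (pm_residues {1, 5, 8, 9, 12, 13, 14, 17, 21, 22, 25, 29} 60) n
        = num_partitions (pm_residues {1, 4, 7, 9, 12, 13, 17, 21, 22, 23, 26, 29} 60) (n - 1))"
proof -
  show ?thesis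
    using num_partitions_shift[where M = 60, OF _ _ _ _ _ _ theta_identities(1)]
      num_partitions_shift[where M = 60, OF _ _ _ _ _ _ theta_identities(2)]
      num_partitions_shift[where M = 60, OF _ _ _ _ _ _ theta_identities(3)]
      num_partitions_shift[where M = 60, OF _ _ _ _ _ _ theta_identities(4)]
    by (intro conjI) force+
qed

end
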